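(* Let $n$ be a positive integer with the Lehmer property, i.e. $n$ is composite and $\varphi(n)\mid n-1$. Let $K$ denote the number of (distinct) prime divisors of $n$. Then $$ n\leq 2^{2^{K}}-2^{2^{K-1}}. $$
   Context: Here $\varphi$ is Euler's totient function. A composite positive integer $n$ is said to have the Lehmer property (or to be a Lehmer number) if $\varphi(n)$ divides $n-1$. *)

theory Defs
  imports "HOL-Number_Theory.Number_Theory"
begin

definition composite :: "nat \<Rightarrow> bool" where
  "composite n \<longleftrightarrow> n > 1 \<and> \<not> prime n"

definition lehmer_number :: "nat \<Rightarrow> bool" where
  "lehmer_number n \<longleftrightarrow> composite n \<and> totient n dvd n - 1"

end

theory Submission
  imports Defs "HOL-Computational_Algebra.Squarefree"
begin

text \<open>
  A Lehmer number \<open>n\<close> is squarefree, and with \<open>k = (n - 1) / totient n\<close> the product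
  of \<open>1 - 1/p\<close> over all primes \<open>p\<close> dividing \<open>n\<close> is below \<open>1/k\<close>, while it exceeds \<open>1/k\<close>
  once the largest prime is left out. For increasing integers \<open>x\<^sub>0, \<dots>, x\<^sub>r\<close> with
  \<open>\<Prod>i\<le>r. (1 - 1/x\<^sub>i) \<le> a/b < \<Prod>i<r. (1 - 1/x\<^sub>i)\<close>, the bound
  \<open>a * \<Prod>i\<le>r. x\<^sub>i \<le> A^2^(r+1) - A^2^r\<close> with \<open>A = a + 1\<close> holds by induction on \<open>r\<close>
  (Heath-Brown, Cook, Nielsen). If \<open>a * \<Prod>i<j. x\<^sub>i < A^2^j\<close> for some \<open>0 < j \<le> r\<close>,
  absorb these factors into \<open>a/b\<close>. Otherwise, if the bound failed, the \<open>x\<^sub>i\<close> would dominate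
  the extremal sequence \<open>A^2^i + 1\<close> \<open>(i < r)\<close>, \<open>A^2^r\<close> in all partial products, and concavity
  of \<open>t \<mapsto> ln (1 - exp (-t))\<close> would give \<open>\<Prod>i\<le>r. (1 - 1/x\<^sub>i) > a/(a+1) \<ge> a/b\<close>.
\<close>

text \<open>The tangent inequality for the concave function \<open>t \<mapsto> ln (1 - exp (-t))\<close> at \<open>t = ln x\<close>.\<close>

lemma ln_one_minus_inverse_tangent:
  fixes x y :: real
  assumes "x > 1" "y > 1"
  shows "(ln x - ln y) / (x - 1) \<le> ln (1 - 1/x) - ln (1 - 1/y)"
proof -
  define u where "u = (1 - 1/x) / (1 - 1/y)"
  have pos: "1 - 1/x > 0" "1 - 1/y > 0" "u > 0"
    using assms by (auto simp: u_def field_simps)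
  \<comment> \<open>The bound \<open>ln t \<le> t - 1\<close> is used twice, at \<open>x / y\<close>
    and at \<open>1 / u\<close>; the identity between the two uses supplies the factor
    \<open>x - 1\<close>.\<close>
  have "ln (x / y) \<le> x / y - 1"
    using assms by (intro ln_le_minus_one) auto
  also have "x / y - 1 = (x - 1) * (1 - 1/u)"
    using assms by (simp add: u_def divide_simps) (simp add: algebra_simps)
  also have "1 - 1/u \<le> ln u"
    using ln_le_minus_one[of "1/u"] pos by (simp add: ln_div)
  finally have "ln (x / y) \<le> (x - 1) * ln u"
    using assms by (simp add: mult_left_mono)
  moreover have "ln u = ln (1 - 1/x) - ln (1 - 1/y)"
    unfolding u_def by (rule ln_divide_pos[OF pos(1,2)])
  ultimately show ?thesis
    using assms by (simp add: ln_div divide_le_eq mult.commute)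
qed

text \<open>A majorization argument: after taking logarithms, the tangent inequality bounds the
  difference below by a sum of \<open>ln (x i) - ln (y i)\<close> with weights
  \<open>1 / (x i - 1)\<close>. These weights are nonincreasing and the partial sums
  \<open>D j\<close> are nonnegative, so Abel summation applies.\<close>

lemma prod_one_minus_inverse_less:
  fixes x y :: "nat \<Rightarrow> real"
  assumes x: "\<And>i. i \<le> r \<Longrightarrow> x i > 1" and y: "\<And>i. i \<le> r \<Longrightarrow> y i > 1"
    and mono: "\<And>i. i < r \<Longrightarrow> x i \<le> x (Suc i)"
    and dom: "\<And>j. j < r \<Longrightarrow> (\<Prod>i\<le>j. y i) \<le> (\<Prod>i\<le>j. x i)"
    and strict: "(\<Prod>i\<le>r. y i) < (\<Prod>i\<le>r. x i)"
  shows "(\<Prod>i\<le>r. 1 - 1 / y i) < (\<Prod>i\<le>r. 1 - 1 / x i)"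
proof -
  define D where "D j = (\<Sum>i\<le>j. ln (x i) - ln (y i))" for j
  have nz: "x i \<noteq> 0" "y i \<noteq> 0" "x i \<noteq> 1" "y i \<noteq> 1" if "i \<le> r" for i
    using x[OF that] y[OF that] by auto
  have D: "D j = ln (\<Prod>i\<le>j. x i) - ln (\<Prod>i\<le>j. y i)" if "j \<le> r" for j
  proof -
    have "ln (\<Prod>i\<le>j. x i) = (\<Sum>i\<le>j. ln (x i))" "ln (\<Prod>i\<le>j. y i) = (\<Sum>i\<le>j. ln (y i))"
      using nz that by (auto intro!: ln_prod)
    thus ?thesis by (simp add: D_def sum_subtractf)
  qed
  have pos: "(\<Prod>i\<le>j. x i) > 0" "(\<Prod>i\<le>j. y i) > 0" if "j \<le> r" for j
    using x y that by (force intro!: prod_pos intro: less_trans[OF zero_less_one])+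
  have posx: "1 - 1 / x i > 0" if "i \<le> r" for i using x[OF that] by simp
  have posy: "1 - 1 / y i > 0" if "i \<le> r" for i using y[OF that] by simp
  have Dnn: "D j \<ge> 0" if "j < r" for j
    using that D[of j] pos[of j] dom[of j] by simp
  \<comment> \<open>Abel summation as an induction: since \<open>D j \<ge> 0\<close>, passing to the
    next, smaller weight can only decrease the left side.\<close>
  have abel: "D j / (x j - 1) \<le> (\<Sum>i\<le>j. (ln (x i) - ln (y i)) / (x i - 1))"
    if "j \<le> r" for j
    using that
  proof (induction j)
    case 0
    show ?case by (simp add: D_def)
  next
    case (Suc j)
    have "D j / (x (Suc j) - 1) \<le> D j / (x j - 1)"
      using Dnn[of j] x[of j] mono[of j] Suc.prems by (intro divide_left_mono) auto
    also have "\<dots> \<le> (\<Sum>i\<le>j. (ln (x i) - ln (y i)) / (x i - 1))"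
      using Suc by simp
    finally show ?case by (simp add: D_def add_divide_distrib)
  qed
  have "D r > 0"
    using D[of r] pos[of r] strict by simp
  hence "0 < D r / (x r - 1)"
    using x[of r] by simp
  also have "\<dots> \<le> (\<Sum>i\<le>r. (ln (x i) - ln (y i)) / (x i - 1))"
    using abel by simp
  also have "\<dots> \<le> (\<Sum>i\<le>r. ln (1 - 1 / x i) - ln (1 - 1 / y i))"
    using x y by (intro sum_mono ln_one_minus_inverse_tangent) auto
  also have "\<dots> = ln (\<Prod>i\<le>r. 1 - 1 / x i) - ln (\<Prod>i\<le>r. 1 - 1 / y i)"
  proof -
    have "ln (\<Prod>i\<le>r. 1 - 1 / x i) = (\<Sum>i\<le>r. ln (1 - 1 / x i))"
      using posx nz by (intro ln_prod) auto
    moreover have "ln (\<Prod>i\<le>r. 1 - 1 / y i) = (\<Sum>i\<le>r. ln (1 - 1 / y i))"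
      using posy nz by (intro ln_prod) auto
    ultimately show ?thesis by (simp add: sum_subtractf)
  qed
  finally have "ln (\<Prod>i\<le>r. 1 - 1 / y i) < ln (\<Prod>i\<le>r. 1 - 1 / x i)" by simp
  moreover have "(\<Prod>i\<le>r. 1 - 1 / x i) > 0" "(\<Prod>i\<le>r. 1 - 1 / y i) > 0"
    using posx posy by (auto intro!: prod_pos simp del: diff_gt_0_iff_gt)
  ultimately show ?thesis by simp
qed

lemma prod_power_two_power_plus_one:
  fixes A :: "'a::comm_ring_1"
  shows "(A - 1) * (\<Prod>i<j. A ^ 2 ^ i + 1) = A ^ 2 ^ j - 1"
proof (induction j)
  case (Suc j)
  have "(A - 1) * (\<Prod>i<Suc j. A ^ 2 ^ i + 1) = (A ^ 2 ^ j - 1) * (A ^ 2 ^ j + 1)"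
    using Suc by (simp add: mult.assoc[symmetric])
  also have "\<dots> = A ^ 2 ^ Suc j - 1"
    by (simp add: algebra_simps flip: power_add mult_2)
  finally show ?case .
qed simp

text \<open>Telescoping from the right: with \<open>B = A ^ 2 ^ j\<close>, the factors for
  \<open>B + 1\<close> and \<open>B * B\<close> merge into \<open>1 - 1 / B\<close>.\<close>

lemma prod_one_minus_inverse_extremal:
  fixes A :: real
  assumes "A > 1"
  shows "(\<Prod>i<j. 1 - 1 / (A ^ 2 ^ i + 1)) * (1 - 1 / A ^ 2 ^ j) = 1 - 1 / A"
proof (induction j)
  case 0
  show ?case by simp
next
  case (Suc j)
  define B where "B = A ^ 2 ^ j"
  have B: "B > 1" unfolding B_def using assms by (intro one_less_power) auto
  have B2: "A ^ 2 ^ Suc j = B * B" by (simp add: B_def mult_2 power_add)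
  have "(1 - 1 / (B + 1)) * (1 - 1 / (B * B)) = 1 - 1 / B"
  proof -
    have "(1 - 1 / (B + 1)) = B / (B + 1)" "1 - 1 / (B * B) = (B - 1) * (B + 1) / (B * B)"
      using B by (auto simp: field_simps)
    moreover have "B / (B + 1) * ((B - 1) * (B + 1) / (B * B)) = 1 - 1 / B"
      using B by (simp add: divide_simps)
    ultimately show ?thesis by simp
  qed
  thus ?case using Suc by (simp add: B2 mult.assoc del: power_Suc flip: B_def)
qed

lemma square_minus_self_mono:
  fixes s t :: real
  assumes "1 \<le> s" "s \<le> t"
  shows "s\<^sup>2 - s \<le> t\<^sup>2 - t"
proof -
  have "s * (s - 1) \<le> t * (t - 1)" using assms by (intro mult_mono) auto
  thus ?thesis by (simp add: power2_eq_square algebra_simps)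
qed

text \<open>A general fraction \<open>a / b\<close> keeps the claim stable under absorbing initial
  factors; Lehmer numbers need \<open>a = 1\<close> and \<open>b = k\<close>.\<close>

lemma mult_prod_le_of_prod_one_minus_inverse:
  fixes a b :: nat and x :: "nat \<Rightarrow> nat"
  assumes "a > 0"
    and "\<And>i. i \<le> r \<Longrightarrow> x i > 1"
    and "\<And>i. i < r \<Longrightarrow> x i \<le> x (Suc i)"
    and "(\<Prod>i\<le>r. 1 - 1 / real (x i)) \<le> a / b"
    and "a / b < (\<Prod>i<r. 1 - 1 / real (x i))"
  shows "real a * (\<Prod>i\<le>r. real (x i)) \<le> (real a + 1) ^ 2 ^ Suc r - (real a + 1) ^ 2 ^ r"
  using assms
proof (induction r arbitrary: a b x rule: less_induct)
  case (less r a b x)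
  define A where "A = real a + 1"
  have A: "A > 1" using \<open>a > 0\<close> by (simp add: A_def)
  have x_pos: "1 - 1 / real (x i) > 0" if "i \<le> r" for i
    using less.prems(2)[OF that] by simp
  have "(\<Prod>i\<le>r. 1 - 1 / real (x i)) > 0"
    using x_pos by (intro prod_pos) auto
  \<comment> \<open>For \<open>b = 0\<close> the fraction would be 0 by convention, below a positive
    product.\<close>
  hence b: "b > 0"
    using less.prems(4) by (cases "b = 0") auto
  have "(\<Prod>i<r. 1 - 1 / real (x i)) \<le> 1"
    using x_pos by (intro prod_le_1) (auto simp del: diff_ge_0_iff_ge intro: less_imp_le)
  hence "real a / real b < 1"
    using less.prems(5) by linarith
  hence ab: "a < b"
    using b by simp
  show ?case
  \<comment> \<open>At \<open>j = 0\<close> the inequality always holds, and absorbing nothing would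
    not shorten the sequence.\<close>
  proof (cases "\<exists>j. 0 < j \<and> j \<le> r \<and> real a * (\<Prod>i<j. real (x i)) + 1 \<le> A ^ 2 ^ j")
    case True
    then obtain j where j: "0 < j" "j \<le> r" "real a * (\<Prod>i<j. real (x i)) + 1 \<le> A ^ 2 ^ j"
      by blast
    define s where "s = r - j"
    have r: "r = s + j" using j by (simp add: s_def)
    \<comment> \<open>Dividing \<open>a / b\<close> by the product \<open>Q\<close> of the first
      \<open>j\<close> factors gives \<open>a' / b'\<close>, so the tail satisfies the hypotheses
      for this fraction.\<close>
    define a' where "a' = a * (\<Prod>i<j. x i)"
    define b' where "b' = b * (\<Prod>i<j. x i - 1)"
    define Q where "Q = (\<Prod>i<j. 1 - 1 / real (x i))"
    have x1: "x i > 1" if "i < j" for i using less.prems(2)[of i] that j by simp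
    have Q: "Q > 0"
      unfolding Q_def using x_pos j by (intro prod_pos) auto
    have Q_eq: "Q = (\<Prod>i<j. real (x i - 1)) / (\<Prod>i<j. real (x i))"
      unfolding Q_def prod_dividef[symmetric]
      by (intro prod.cong) (auto dest!: x1 simp: of_nat_diff field_simps)
    have ab': "real a' / real b' = (a / b) / Q"
      by (simp add: a'_def b'_def Q_eq)
    have split_le: "(\<Prod>i\<le>s + j. f i) = (\<Prod>i<j. f i) * (\<Prod>i\<le>s. f (i + j))"
      and split_less: "(\<Prod>i<s + j. f i) = (\<Prod>i<j. f i) * (\<Prod>i<s. f (i + j))"
      for f :: "nat \<Rightarrow> real"
    proof -
      show *: "(\<Prod>i<s + j. f i) = (\<Prod>i<j. f i) * (\<Prod>i<s. f (i + j))" for s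
        by (induction s) (simp_all add: mult.assoc)
      show "(\<Prod>i\<le>s + j. f i) = (\<Prod>i<j. f i) * (\<Prod>i\<le>s. f (i + j))"
        using *[of "Suc s"] by (simp add: lessThan_Suc_atMost del: prod.lessThan_Suc)
    qed
    have a': "a' > 0" using less.prems(1) x1 by (force simp: a'_def intro!: prod_pos)
    have "real a' * (\<Prod>i\<le>s. real (x (i + j)))
            \<le> (real a' + 1) ^ 2 ^ Suc s - (real a' + 1) ^ 2 ^ s"
    proof (rule less.IH)
      show "s < r" using r j by simp
      show "a' > 0" by (fact a')
      show "x (i + j) > 1" if "i \<le> s" for i using less.prems(2) that r by simp
      show "x (i + j) \<le> x (Suc i + j)" if "i < s" for i
        using less.prems(3)[of "i + j"] that r by simp
      show "(\<Prod>i\<le>s. 1 - 1 / real (x (i + j))) \<le> real a' / real b'"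
        using less.prems(4) Q
        unfolding ab' r split_le Q_def[symmetric] pos_le_divide_eq[OF Q] by (simp only: mult.commute)
      show "real a' / real b' < (\<Prod>i<s. 1 - 1 / real (x (i + j)))"
        using less.prems(5) Q
        unfolding ab' r split_less Q_def[symmetric] pos_divide_less_eq[OF Q] by (simp only: mult.commute)
    qed
    also have "\<dots> = ((real a' + 1) ^ 2 ^ s)\<^sup>2 - (real a' + 1) ^ 2 ^ s"
      by (simp add: mult.commute flip: power_mult)
    also have "\<dots> \<le> (A ^ 2 ^ r)\<^sup>2 - A ^ 2 ^ r"
    proof (rule square_minus_self_mono)
      show "1 \<le> (real a' + 1) ^ 2 ^ s" by (intro one_le_power) auto
      have "(real a' + 1) ^ 2 ^ s \<le> (A ^ 2 ^ j) ^ 2 ^ s"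
        using j(3) by (intro power_mono) (simp_all add: a'_def add_nonneg_nonneg prod_nonneg)
      also have "\<dots> = A ^ 2 ^ r"
        by (simp add: r power_add mult.commute flip: power_mult)
      finally show "(real a' + 1) ^ 2 ^ s \<le> A ^ 2 ^ r" .
    qed
    also have "(A ^ 2 ^ r)\<^sup>2 = A ^ 2 ^ Suc r"
      by (simp add: mult.commute flip: power_mult)
    finally show ?thesis
      by (simp add: r split_le a'_def A_def mult.assoc)
  next
    case False
    show ?thesis
    proof (rule ccontr)
      assume neg: "\<not> ?thesis"
      \<comment> \<open>Without \<open>+ 1\<close> in the last term, both products are exact:
        \<open>a\<close> times the product of the \<open>y i\<close> is the claimed bound, and the
        product of the \<open>1 - 1 / y i\<close> is \<open>1 - 1 / A\<close>.\<close>
      define y where "y i = (if i < r then A ^ 2 ^ i + 1 else A ^ 2 ^ r)" for i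
      have yj: "real a * (\<Prod>i<j. y i) = A ^ 2 ^ j - 1" if "j \<le> r" for j
      proof -
        have "(\<Prod>i<j. y i) = (\<Prod>i<j. A ^ 2 ^ i + 1)"
          using that by (intro prod.cong) (auto simp: y_def)
        thus ?thesis using prod_power_two_power_plus_one[of A j] by (simp add: A_def)
      qed
      have "(\<Prod>i\<le>r. 1 - 1 / y i) < (\<Prod>i\<le>r. 1 - 1 / real (x i))"
      proof (rule prod_one_minus_inverse_less)
        show "real (x i) > 1" if "i \<le> r" for i using less.prems(2)[OF that] by simp
        show "y i > 1" if "i \<le> r" for i
          using A by (auto simp: y_def intro!: one_less_power)
        show "real (x i) \<le> real (x (Suc i))" if "i < r" for i
          using less.prems(3)[OF that] by simp
        show "(\<Prod>i\<le>j. y i) \<le> (\<Prod>i\<le>j. real (x i))" if "j < r" for j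
        proof -
          have "\<not> real a * (\<Prod>i<Suc j. real (x i)) + 1 \<le> A ^ 2 ^ Suc j"
            using False that by (meson Suc_leI zero_less_Suc)
          moreover have "real a * (\<Prod>i<Suc j. y i) = A ^ 2 ^ Suc j - 1"
            using that by (intro yj) simp
          ultimately have "real a * (\<Prod>i<Suc j. y i) \<le> real a * (\<Prod>i<Suc j. real (x i))"
            by linarith
          thus ?thesis
            using less.prems(1) by (simp add: lessThan_Suc_atMost del: prod.lessThan_Suc)
        qed
        have "real a * (\<Prod>i\<le>r. y i) = (A ^ 2 ^ r - 1) * A ^ 2 ^ r"
          using yj[of r] by (simp add: y_def flip: lessThan_Suc_atMost mult.assoc)
        also have "\<dots> = A ^ 2 ^ Suc r - A ^ 2 ^ r"
          by (simp add: algebra_simps mult_2 power_add)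
        also have "\<dots> < real a * (\<Prod>i\<le>r. real (x i))"
          using neg by (simp add: A_def)
        finally show "(\<Prod>i\<le>r. y i) < (\<Prod>i\<le>r. real (x i))"
          using less.prems(1) by simp
      qed
      also have "(\<Prod>i\<le>r. 1 - 1 / y i) = 1 - 1 / A"
      proof -
        have "(\<Prod>i\<le>r. 1 - 1 / y i) = (\<Prod>i<r. 1 - 1 / y i) * (1 - 1 / y r)"
          by (simp flip: lessThan_Suc_atMost)
        also have "(\<Prod>i<r. 1 - 1 / y i) = (\<Prod>i<r. 1 - 1 / (A ^ 2 ^ i + 1))"
          by (intro prod.cong) (auto simp: y_def)
        finally show ?thesis
          using prod_one_minus_inverse_extremal[OF A, of r] by (simp add: y_def)
      qed
      also have "1 - 1 / A = a / (a + 1)"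
        by (simp add: A_def field_simps)
      finally have "real a / (a + 1) < a / b"
        using less.prems(4) by simp
      \<comment> \<open>Integrality turns \<open>a < b\<close> into
        \<open>a + 1 \<le> b\<close>.\<close>
      moreover have "real a / b \<le> real a / (a + 1)"
        using ab by (intro divide_left_mono) auto
      ultimately show False by simp
    qed
  qed
qed

text \<open>If \<open>p\<^sup>2\<close> divides \<open>n\<close>, then the prime \<open>p\<close>
  divides both \<open>n\<close> and \<open>totient n\<close>.\<close>

lemma squarefree_if_coprime_totient:
  fixes n :: nat
  assumes "n > 0" "coprime n (totient n)"
  shows "squarefree n"
proof (rule ccontr)
  assume "\<not> squarefree n"
  then obtain p where p: "p\<^sup>2 dvd n" "prime p"
    using \<open>n > 0\<close> by (auto simp: squarefree_factorial_semiring)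
  have "p dvd totient (p\<^sup>2)"
    using p by (simp add: totient_prime_power)
  also have "totient (p\<^sup>2) dvd totient n"
    using p by (intro totient_dvd)
  finally have "p dvd totient n" .
  moreover have "p dvd n" using p by (auto simp: power2_eq_square dest: dvd_mult_left)
  ultimately have "is_unit p" using assms(2) by (auto simp: coprime_def)
  with p show False by auto
qed

theorem theorem2p2:
  fixes n K :: nat
  assumes "lehmer_number n"
    and "K = card (prime_factors n)"
  shows "int n \<le> 2 ^ (2 ^ K) - 2 ^ (2 ^ (K - 1))"
proof -
  have n: "n > 1" "\<not> prime n" and dvd: "totient n dvd n - 1"
    using assms(1) by (auto simp: lehmer_number_def composite_def)
  have "coprime n (n - 1)"
    using n coprime_diff_one_right_nat[of n] by simp
  hence sqf: "squarefree n"
    using n dvd by (intro squarefree_if_coprime_totient) (auto intro: coprime_divisors)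
  \<comment> \<open>Sorting makes \<open>x r\<close> the largest prime divisor.\<close>
  define xs where "xs = sorted_list_of_set (prime_factors n)"
  define x where "x i = xs ! i" for i
  have len: "length xs = K" by (simp add: xs_def assms(2))
  have bij: "bij_betw x {..<K} (prime_factors n)"
    unfolding x_def using len by (intro bij_betw_nth) (auto simp: xs_def)
  have reindex: "(\<Prod>i<K. f (x i)) = (\<Prod>p\<in>prime_factors n. f p)" for f :: "nat \<Rightarrow> real"
    using prod.reindex_bij_betw[OF bij] .
  have "prime_factors n \<noteq> {}" using n by (simp add: prime_factorization_empty_iff)
  hence "K > 0" using assms(2) by (simp add: card_gt_0_iff)
  then obtain r where K: "K = Suc r" by (cases K) auto
  have x_prime: "x i \<in> prime_factors n" if "i \<le> r" for i
    using bij_betwE[OF bij] that K by auto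
  have x1: "x i > 1" if "i \<le> r" for i
    using x_prime[OF that] by (intro prime_gt_1_nat) auto
  have n_eq: "(\<Prod>i\<le>r. real (x i)) = n"
  proof -
    have "n = (\<Prod>p\<in>prime_factors n. p)"
    proof -
      have "multiplicity p n = 1" if "p \<in> prime_factors n" for p
        using sqf n that squarefree_factorial_semiring'[of n] by auto
      thus ?thesis using n prime_factorization_nat[of n] by simp
    qed
    thus ?thesis using reindex[of real]
      by (simp add: K lessThan_Suc_atMost flip: of_nat_prod)
  qed
  obtain k where k: "n - 1 = totient n * k" using dvd by (elim dvdE)
  have k0: "k > 0" using k n by (cases k) auto
  define P where "P = (\<Prod>i<r. 1 - 1 / real (x i))"
  have tot: "real (totient n) = n * (P * (1 - 1 / real (x r)))"
    using totient_formula2[of n] reindex[of "\<lambda>p. 1 - 1 / real p"] by (simp add: K P_def)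
  have "real n - 1 = totient n * k"
    using k n by (metis of_nat_1 of_nat_diff of_nat_mult less_imp_le)
  hence nk: "real n - 1 = n * (P * (1 - 1 / real (x r))) * k"
    by (simp only: of_nat_mult tot)
  \<comment> \<open>Compositeness enters here.\<close>
  have xr: "real (x r) < n"
  proof -
    have "x r dvd n" "prime (x r)" using x_prime[of r] by auto
    hence "x r \<le> n" "x r \<noteq> n" using n by (auto intro: dvd_imp_le)
    thus ?thesis by simp
  qed
  have "real 1 * (\<Prod>i\<le>r. real (x i)) \<le> (real 1 + 1) ^ 2 ^ Suc r - (real 1 + 1) ^ 2 ^ r"
  proof (rule mult_prod_le_of_prod_one_minus_inverse)
    show "x i \<le> x (Suc i)" if "i < r" for i
      unfolding x_def using that len K by (intro sorted_nth_mono) (auto simp: xs_def)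
    have "real n * (k * (P * (1 - 1 / real (x r)))) < n"
      using nk by (simp add: mult_ac)
    hence "real k * (P * (1 - 1 / real (x r))) < 1"
      using n by simp
    thus "(\<Prod>i\<le>r. 1 - 1 / real (x i)) \<le> real 1 / real k"
      using k0 by (simp add: P_def field_simps flip: lessThan_Suc_atMost)
    \<comment> \<open>By \<open>nk\<close>, \<open>k\<close> times the full product is
      \<open>(n - 1) / n\<close>. Dropping the last factor divides this by
      \<open>1 - 1 / x r\<close>, which is smaller than \<open>1 - 1 / n\<close> because
      \<open>x r < n\<close>, so the result exceeds 1.\<close>
    have "real n * (real (x r) - 1) < (real n - 1) * x r"
      using xr by (simp add: algebra_simps)
    also have "\<dots> = n * (k * P * (real (x r) - 1))"
      using x1[of r] unfolding nk by (simp add: field_simps)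
    finally have "n * (real (x r) - 1) < n * (k * P * (real (x r) - 1))" .
    hence "real k * P > 1" using n x1[of r] by simp
    thus "real 1 / real k < (\<Prod>i<r. 1 - 1 / real (x i))"
      using k0 by (simp add: P_def field_simps)
  qed (use x1 in auto)
  hence "real n \<le> 2 ^ 2 ^ K - 2 ^ 2 ^ (K - 1)"
    by (simp add: n_eq K)
  hence "real_of_int (int n) \<le> real_of_int (2 ^ 2 ^ K - 2 ^ 2 ^ (K - 1))"
    by simp
  thus ?thesis by (simp only: of_int_le_iff)
qed

end
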